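(* Let $d\ge2$ and suppose that $t>\frac1{\mu_d}$. Define $\zeta_d=\log\frac{\mu_d}{\mu_{d-1}}$ (with $\mu_1=1$). For $N\ge1$ let $G_N(a,t)=\sum_{n=0}^N A_n^+(a)t^n$, regarded as a polynomial of degree $N$ in $a$, and for $\rho\in(0,1)$ let $\nu_N(\rho)$ be the number of its $a$-plane zeros (Yang-Lee zeros, with multiplicity) in the annulus $1-\rho\le|a|\le\frac1{1-\rho}$. If $\zeta_d<\rho<1$, then \[ 0<1-\frac1\rho\zeta_d\le\liminf_{N\to\infty}\frac1N\nu_N(\rho)\le\limsup_{N\to\infty}\frac1N\nu_N(\rho)\le1, \] and a positive fraction of Yang-Lee zeros of $G_N(a,t)$ are in the annulus $1-\rho<|a|<\frac1{1-\rho}$ in the complex $a$-plane.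
   Context: Let $\mathbb{L}^d_+$ be the half-lattice of the $d$-dimensional hypercubic lattice (vertices with last coordinate $\ge0$). A positive walk is a self-avoiding walk in $\mathbb{L}^d_+$ starting at the origin; its visits are its vertices other than the origin with last coordinate $0$. $c_n^+(v)$ is the number of positive walks of length $n$ with $v$ visits and $A_n^+(a)=\sum_{v=0}^n c_n^+(v)a^v$. $\mu_d$ and $\mu_{d-1}$ are the growth constants of self-avoiding walks in $d$ and $d-1$ dimensions, with the convention $\mu_1=1$. *)

theory Defs
  imports "HOL-Analysis.Analysis" "HOL-Computational_Algebra.Polynomial"
begin

text \<open>Vertices of the d-dimensional hypercubic lattice are integer lists of length d;
  the last coordinate is the entry with index d - 1.\<close>

definition lattice_adj :: "int list \<Rightarrow> int list \<Rightarrow> bool" where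
  "lattice_adj u v \<longleftrightarrow> length u = length v \<and> (\<Sum>i<length u. \<bar>u ! i - v ! i\<bar>) = 1"

definition saw :: "nat \<Rightarrow> nat \<Rightarrow> int list list set" where
  "saw d n = {w. length w = n + 1 \<and> (\<forall>x\<in>set w. length x = d) \<and> w ! 0 = replicate d 0
     \<and> distinct w \<and> (\<forall>i<n. lattice_adj (w ! i) (w ! Suc i))}"

definition saw_count :: "nat \<Rightarrow> nat \<Rightarrow> nat" where
  "saw_count d n = card (saw d n)"

definition growth_const :: "nat \<Rightarrow> real" where
  "growth_const d = (if d = 1 then 1 else lim (\<lambda>n. root n (real (saw_count d n))))"

definition pos_walks :: "nat \<Rightarrow> nat \<Rightarrow> int list list set" where
  "pos_walks d n = {w \<in> saw d n. \<forall>x\<in>set w. x ! (d - 1) \<ge> 0}"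

definition visits :: "nat \<Rightarrow> int list list \<Rightarrow> nat" where
  "visits d w = card {i \<in> {1..<length w}. (w ! i) ! (d - 1) = 0}"

definition cplus :: "nat \<Rightarrow> nat \<Rightarrow> nat \<Rightarrow> nat" where
  "cplus d n v = card {w \<in> pos_walks d n. visits d w = v}"

definition Aplus :: "nat \<Rightarrow> nat \<Rightarrow> 'a::comm_semiring_1 \<Rightarrow> 'a" where
  "Aplus d n a = (\<Sum>v=0..n. of_nat (cplus d n v) * a ^ v)"

definition GN :: "nat \<Rightarrow> nat \<Rightarrow> real \<Rightarrow> complex poly" where
  "GN d N t = (\<Sum>n=0..N. \<Sum>v=0..n. monom (complex_of_real (real (cplus d n v) * t ^ n)) v)"

definition zeros_in :: "complex poly \<Rightarrow> complex set \<Rightarrow> nat" where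
  "zeros_in p S = (\<Sum>z\<in>{z\<in>S. poly p z = 0}. order z p)"

definition closed_annulus :: "real \<Rightarrow> complex set" where
  "closed_annulus \<rho> = {a. 1 - \<rho> \<le> cmod a \<and> cmod a \<le> 1 / (1 - \<rho>)}"

definition open_annulus :: "real \<Rightarrow> complex set" where
  "open_annulus \<rho> = {a. 1 - \<rho> < cmod a \<and> cmod a < 1 / (1 - \<rho>)}"

lemma GN_poly: "poly (GN d N t) a = (\<Sum>n=0..N. Aplus d n a * complex_of_real t ^ n)"
  by (simp add: GN_def Aplus_def poly_sum poly_monom sum_distrib_left sum_distrib_right mult_ac)

end

theory Submission
  imports "Berlekamp_Zassenhaus.Mahler_Measure" "HOL-Real_Asymp.Real_Asymp" Defs
begin

text \<open>
  For a polynomial of degree N with zeros z and nonzero constant and leading coefficients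
  \<open>a\<^sub>0\<close>, \<open>a\<^sub>N\<close>, each zero outside the closed annulus contributes at least \<open>\<rho>\<close> to the sum of
  \<open>\<bar>ln \<bar>z\<bar>\<bar>\<close>, and by Landau's inequality for the Mahler measure that sum is at most
  \<open>ln (M\<^sup>2 / \<bar>a\<^sub>0 a\<^sub>N\<bar>)\<close>, where M is the sum of the absolute values of the coefficients. For
  \<open>G\<^sub>N\<close> the coefficient \<open>a\<^sub>0\<close> is comparable to M, while M is at most \<open>(t \<mu>\<^sub>d)\<^sup>N\<close> up to a factor
  \<open>exp (o(N))\<close>, and walks inside the boundary hyperplane give \<open>a\<^sub>N \<ge> (t \<mu>\<^sub>d\<^sub>-\<^sub>1)\<^sup>N\<close>. Hence at most
  \<open>N \<zeta>\<^sub>d / \<rho> + o(N)\<close> zeros lie outside the annulus. Only an upper bound on the number of positive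
  walks is needed, so their growth constant never has to be identified. The open annulus contains
  a closed one for a slightly smaller \<open>\<rho>\<close>.
\<close>

section \<open>Zeros of a polynomial in an annulus\<close>

text \<open>Connects two descriptions of the zeros: the Mahler measure is a product over the list
  \<open>complex_roots_complex p\<close>, while \<open>zeros_in\<close> counts by
  \<open>order\<close>, which is the multiplicity in \<open>proots p\<close>.\<close>

lemma proots_eq_mset_complex_roots:
  assumes "p \<noteq> 0"
  shows "proots p = mset (complex_roots_complex p)"
proof -
  have *: "proots (\<Prod>a\<leftarrow>as. [:- a, 1:]) = mset as" for as :: "complex list"
  proof (induction as)
    case (Cons a as)
    have "(\<Prod>a\<leftarrow>as. [:- a, 1:]) \<noteq> 0"
      by (auto simp: prod_list_zero_iff)
    then show ?case
      using Cons proots_linear_factor[of "- a"] by (simp add: proots_mult del: mult_pCons_left)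
  qed simp
  have "proots p = proots (smult (lead_coeff p) (\<Prod>a\<leftarrow>complex_roots_complex p. [:- a, 1:]))"
    by (simp only: complex_roots(1))
  also have "\<dots> = mset (complex_roots_complex p)"
    using assms * by simp
  finally show ?thesis .
qed

text \<open>Turns the sum of multiplicities into a list length, so that statements about zeros can
  be proved by induction over the list of zeros.\<close>

lemma zeros_in_eq_length_filter:
  assumes "p \<noteq> 0"
  shows "zeros_in p S = length (filter (\<lambda>z. z \<in> S) (complex_roots_complex p))"
proof -
  let ?M = "filter_mset (\<lambda>z. z \<in> S) (proots p)"
  have "zeros_in p S = (\<Sum>z\<in>set_mset ?M. count ?M z)"
    using assms unfolding zeros_in_def by (intro sum.cong) auto
  also have "\<dots> = size ?M"
    by (simp add: size_multiset_overloaded_eq)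
  also have "\<dots> = length (filter (\<lambda>z. z \<in> S) (complex_roots_complex p))"
    by (simp add: proots_eq_mset_complex_roots[OF assms] flip: mset_filter)
  finally show ?thesis .
qed

lemma zeros_in_le_degree:
  assumes "p \<noteq> 0"
  shows "zeros_in p S \<le> degree p"
  unfolding zeros_in_eq_length_filter[OF assms]
  using length_filter_le[of _ "complex_roots_complex p"] by simp

lemma zeros_in_mono:
  assumes "p \<noteq> 0" "S \<subseteq> T"
  shows "zeros_in p S \<le> zeros_in p T"
  unfolding zeros_in_def using assms poly_roots_finite[of p]
  by (intro sum_mono2) auto

text \<open>Landau's inequality speaks of the Euclidean norm of the coefficients, whereas counting
  walks controls their sum.\<close>

lemma l2norm_complex_le_sum_cmod:
  "l2norm_complex p \<le> (\<Sum>i\<le>degree p. cmod (coeff p i))"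
proof (cases "p = 0")
  case False
  have "norm2 p = (\<Sum>i\<le>degree p. (cmod (coeff p i))\<^sup>2)"
    using False by (simp add: coeffs_def interv_sum_list_conv_sum_set_nat atLeast0LessThan
      lessThan_Suc_atMost flip: sum.atLeast_Suc_atMost del: upt_Suc)
  then show ?thesis
    using L2_set_le_sum[of "{..degree p}" "\<lambda>i. cmod (coeff p i)"] by (simp add: L2_set_def)
qed simp

text \<open>The two radii are reciprocal, so both cases reduce to
  \<open>ln (1 - \<rho>) \<le> - \<rho>\<close>.\<close>

lemma abs_ln_cmod_ge:
  assumes "0 < \<rho>" "\<rho> < 1" "z \<noteq> 0" "z \<notin> closed_annulus \<rho>"
  shows "\<rho> \<le> \<bar>ln (cmod z)\<bar>"
proof -
  have r: "ln (1 - \<rho>) \<le> - \<rho>"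
    using ln_le_minus_one[of "1 - \<rho>"] assms by simp
  from assms(4) consider "cmod z < 1 - \<rho>" | "cmod z > 1 / (1 - \<rho>)"
    unfolding closed_annulus_def by fastforce
  then show ?thesis
  proof cases
    case 1
    then have "ln (cmod z) \<le> ln (1 - \<rho>)"
      using assms by simp
    with r show ?thesis by linarith
  next
    case 2
    moreover have "1 / (1 - \<rho>) > 0" using assms by simp
    ultimately have "ln (1 / (1 - \<rho>)) \<le> ln (cmod z)"
      by (intro ln_mono) auto
    then show ?thesis
      using r assms by (simp add: ln_div)
  qed
qed

text \<open>Each zero outside the annulus contributes at least \<open>\<rho>\<close> and each zero
  inside at least 0.\<close>

lemma sum_list_abs_ln_ge:
  assumes "\<And>z. z \<in> set zs \<Longrightarrow> z \<noteq> 0" "0 < \<rho>" "\<rho> < 1"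
  shows "\<rho> * (real (length zs) - real (length (filter (\<lambda>z. z \<in> closed_annulus \<rho>) zs)))
           \<le> (\<Sum>z\<leftarrow>zs. \<bar>ln (cmod z)\<bar>)"
  using assms(1)
proof (induction zs)
  case (Cons z zs)
  then show ?case
    using abs_ln_cmod_ge[of \<rho> z] assms by (cases "z \<in> closed_annulus \<rho>") (auto simp: algebra_simps)
qed simp

text \<open>Holds term by term. The first product is the Mahler measure up to the leading
  coefficient, the second is the modulus of the constant coefficient up to the same factor.\<close>

lemma sum_list_abs_ln_eq:
  assumes "\<And>z. z \<in> set zs \<Longrightarrow> z \<noteq> 0"
  shows "(\<Sum>z\<leftarrow>zs. \<bar>ln (cmod z)\<bar>) =
    2 * ln (\<Prod>z\<leftarrow>zs. max 1 (cmod z)) - ln (\<Prod>z\<leftarrow>zs. cmod z)"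
  using assms
proof (induction zs)
  case (Cons z zs)
  have "(\<Prod>z\<leftarrow>zs. max 1 (cmod z)) \<noteq> 0" "(\<Prod>z\<leftarrow>zs. cmod z) \<noteq> 0"
    using Cons.prems by (auto simp: prod_list_zero_iff)
  moreover have "\<bar>ln (cmod z)\<bar> = 2 * ln (max 1 (cmod z)) - ln (cmod z)"
    using Cons.prems by (auto simp: max_def abs_if ln_less_zero_iff)
  ultimately show ?case
    using Cons by (simp add: ln_mult)
qed simp

text \<open>With M the Mahler measure of \<open>p\<close>, the sum of
  \<open>\<bar>ln (cmod z)\<bar>\<close> over the zeros equals 2 ln M minus the logarithms of the
  moduli of the constant and leading coefficients. Landau's inequality bounds M.\<close>

theorem zeros_in_closed_annulus_ge:
  fixes p :: "complex poly"
  assumes "0 < \<rho>" "\<rho> < 1" "coeff p 0 \<noteq> 0"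
  shows "\<rho> * (real (degree p) - real (zeros_in p (closed_annulus \<rho>))) \<le>
    2 * ln (\<Sum>i\<le>degree p. cmod (coeff p i)) - ln (cmod (coeff p 0)) - ln (cmod (lead_coeff p))"
proof -
  define zs where "zs = complex_roots_complex p"
  have p: "p \<noteq> 0" using assms(3) by auto
  have len: "length zs = degree p" by (simp add: zs_def)
  have fact: "smult (lead_coeff p) (\<Prod>a\<leftarrow>zs. [:- a, 1:]) = p"
    unfolding zs_def by (rule complex_roots)
  \<comment> \<open>Evaluating the factorization at 0 expresses the constant coefficient through the
    product of the zeros.\<close>
  have "coeff p 0 = poly (smult (lead_coeff p) (\<Prod>a\<leftarrow>zs. [:- a, 1:])) 0"
    by (simp only: fact poly_0_coeff_0)
  also have "cmod \<dots> = cmod (lead_coeff p) * (\<Prod>z\<leftarrow>zs. cmod z)"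
    by (simp add: poly_prod_list norm_mult o_def)
  finally have c0: "cmod (coeff p 0) = cmod (lead_coeff p) * (\<Prod>z\<leftarrow>zs. cmod z)" .
  then have nz: "(\<Prod>z\<leftarrow>zs. cmod z) \<noteq> 0"
    using assms(3) by (metis mult_zero_right norm_eq_zero)
  then have zs: "z \<noteq> 0" if "z \<in> set zs" for z
    using that by (auto simp: prod_list_zero_iff)
  have "cmod (lead_coeff p) * (\<Prod>z\<leftarrow>zs. max 1 (cmod z)) \<le> (\<Sum>i\<le>degree p. cmod (coeff p i))"
    using Landau_inequality[of p] l2norm_complex_le_sum_cmod[of p]
    by (simp add: mahler_measure_poly_def zs_def)
  moreover have maxpos: "(\<Prod>z\<leftarrow>zs. max 1 (cmod z)) > 0"
    using prod_list_ge1[of "map (\<lambda>z. max 1 (cmod z)) zs"] by simp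
  ultimately have "ln (cmod (lead_coeff p) * (\<Prod>z\<leftarrow>zs. max 1 (cmod z)))
      \<le> ln (\<Sum>i\<le>degree p. cmod (coeff p i))"
    using p by (intro ln_mono) (auto intro: mult_pos_pos)
  then have mahler: "ln (cmod (lead_coeff p)) + ln (\<Prod>z\<leftarrow>zs. max 1 (cmod z))
      \<le> ln (\<Sum>i\<le>degree p. cmod (coeff p i))"
    using p maxpos by (simp add: ln_mult_pos)
  have "ln (cmod (coeff p 0)) = ln (cmod (lead_coeff p)) + ln (\<Prod>z\<leftarrow>zs. cmod z)"
    unfolding c0 using p nz by (simp add: ln_mult)
  then show ?thesis
    using mahler sum_list_abs_ln_ge[of zs \<rho>, OF zs assms(1,2)] sum_list_abs_ln_eq[of zs, OF zs]
    unfolding zeros_in_eq_length_filter[OF p] zs_def[symmetric] len by linarith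
qed

section \<open>Submultiplicative sequences\<close>

lemma submultiplicative_le_power:
  fixes f :: "nat \<Rightarrow> real"
  assumes ge1: "\<And>n. f n \<ge> 1" and sub: "\<And>m n. f (m + n) \<le> f m * f n"
  shows "f (q * m + r) \<le> f m ^ q * f r"
proof (induction q)
  case (Suc q)
  have "f (Suc q * m + r) \<le> f m * f (q * m + r)"
    using sub[of m "q * m + r"] by (simp add: ac_simps)
  also have "\<dots> \<le> f m * (f m ^ q * f r)"
    using Suc ge1[of m] by (intro mult_left_mono) auto
  finally show ?case by (simp add: ac_simps)
qed simp

text \<open>Fekete's argument: the limit is the infimum of the roots over positive \<open>n\<close>,
  which also gives \<open>L ^ n \<le> f n\<close> for every \<open>n\<close>.\<close>

theorem fekete_submultiplicative:
  fixes f :: "nat \<Rightarrow> real"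
  assumes ge1: "\<And>n. f n \<ge> 1" and sub: "\<And>m n. f (m + n) \<le> f m * f n"
  obtains L where "L \<ge> 1" "(\<lambda>n. root n (f n)) \<longlonglongrightarrow> L" "\<And>n. L ^ n \<le> f n"
proof -
  define L where "L = (INF n\<in>{1..}. root n (f n))"
  have root_ge1: "1 \<le> root n (f n)" if "n \<ge> 1" for n
    using ge1[of n] that by simp
  have bdd: "bdd_below ((\<lambda>n. root n (f n)) ` {1..})"
    using root_ge1 by (intro bdd_belowI[of _ 1]) auto
  have L_le: "L \<le> root n (f n)" if "n \<ge> 1" for n
    unfolding L_def using bdd that by (intro cINF_lower) auto
  have L1: "L \<ge> 1"
    unfolding L_def using root_ge1 by (intro cINF_greatest) auto
  have "L ^ n \<le> f n" for n
  proof (cases "n = 0")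
    case False
    then have "L ^ n \<le> root n (f n) ^ n"
      using L_le L1 by (intro power_mono) auto
    also have "\<dots> = f n"
      using False ge1[of n] by (intro real_root_pow_pos2) auto
    finally show ?thesis .
  qed (use ge1 in simp)
  moreover have "(\<lambda>n. root n (f n)) \<longlonglongrightarrow> L"
  proof (rule order_tendstoI)
    fix y assume "y < L"
    show "\<forall>\<^sub>F n in sequentially. y < root n (f n)"
      using eventually_ge_at_top[of 1] by eventually_elim (use L_le \<open>y < L\<close> in force)
  next
    fix y assume "L < y"
    \<comment> \<open>As \<open>L\<close> is an infimum, some single index \<open>m\<close> already
      has its root below \<open>y\<close>; writing \<open>n\<close> as a multiple of
      \<open>m\<close> plus a remainder carries this over to all large \<open>n\<close>.\<close>
    then obtain m where m: "m \<ge> 1" "root m (f m) < y"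
      unfolding L_def using cINF_less_iff[OF _ bdd] by auto
    define g where "g = root m (f m)"
    \<comment> \<open>\<open>B\<close> bounds every remainder factor \<open>f r\<close> with
      \<open>r < m\<close>; its n-th root tends to 1, so it disappears in the limit.\<close>
    define B where "B = (\<Sum>r<m. f r)"
    have g1: "g \<ge> 1" and gy: "g < y" using root_ge1 m by (auto simp: g_def)
    have fB: "f r \<le> B" if "r < m" for r
      unfolding B_def using that ge1 order_trans[OF zero_le_one ge1]
      by (intro member_le_sum) auto
    have Bpos: "B > 0" using fB[of 0] ge1[of 0] m by simp
    have bound: "root n (f n) \<le> root n B * g" if "n \<ge> 1" for n
    proof -
      have "f n = f (n div m * m + n mod m)" by simp
      also have "\<dots> \<le> f m ^ (n div m) * f (n mod m)"
        by (rule submultiplicative_le_power[OF ge1 sub])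
      also have "f m = g ^ m"
        unfolding g_def using m ge1[of m] by (intro real_root_pow_pos2[symmetric]) auto
      also have "(g ^ m) ^ (n div m) * f (n mod m) = g ^ (m * (n div m)) * f (n mod m)"
        by (simp add: power_mult)
      also have "\<dots> \<le> g ^ n * B"
        using g1 m fB[of "n mod m"] order_trans[OF zero_le_one ge1]
        by (intro mult_mono power_increasing) (auto simp: mult.commute)
      finally have "root n (f n) \<le> root n (g ^ n * B)"
        using that by simp
      also have "\<dots> = root n B * g"
        using that g1 by (simp add: real_root_mult real_root_power_cancel)
      finally show ?thesis .
    qed
    have "(\<lambda>n. root n B * g) \<longlonglongrightarrow> 1 * g"
      by (intro tendsto_intros LIMSEQ_root_const Bpos)
    then have "\<forall>\<^sub>F n in sequentially. root n B * g < y"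
      using gy by (intro order_tendstoD) auto
    then show "\<forall>\<^sub>F n in sequentially. root n (f n) < y"
      using eventually_ge_at_top[of 1] by eventually_elim (use bound in force)
  qed
  ultimately show thesis using L1 that by blast
qed

section \<open>Self-avoiding walks and growth constants\<close>

text \<open>Self-avoiding walks with arbitrary length and starting point, since pieces and images of
  walks need not start at the origin.\<close>

definition sa_path :: "nat \<Rightarrow> int list list \<Rightarrow> bool" where
  "sa_path d w \<longleftrightarrow> (\<forall>x\<in>set w. length x = d) \<and> distinct w \<and> successively lattice_adj w"

lemma saw_iff_sa_path:
  "w \<in> saw d n \<longleftrightarrow> length w = n + 1 \<and> hd w = replicate d 0 \<and> sa_path d w"
proof (cases "length w = n + 1")
  case True
  then have "w \<noteq> []" by auto
  with True show ?thesis
    unfolding saw_def sa_path_def by (auto simp: successively_conv_nth hd_conv_nth)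
qed (simp add: saw_def)

text \<open>Covers translation, vertical lifting and embedding into one more dimension; the last of
  these is why \<open>e\<close> may differ from \<open>d\<close>.\<close>

lemma sa_path_map:
  assumes "sa_path d w" "inj_on h {x. length x = d}"
    and "\<And>x. length x = d \<Longrightarrow> length (h x) = e"
    and "\<And>x y. length x = d \<Longrightarrow> length y = d \<Longrightarrow> lattice_adj x y \<Longrightarrow> lattice_adj (h x) (h y)"
  shows "sa_path e (map h w)"
proof -
  have w: "\<And>x. x \<in> set w \<Longrightarrow> length x = d" "distinct w" "successively lattice_adj w"
    using assms(1) by (auto simp: sa_path_def)
  have "inj_on h (set w)"
    using w(1) by (intro inj_on_subset[OF assms(2)]) auto
  moreover have "successively (\<lambda>x y. lattice_adj (h x) (h y)) w"
    by (rule successively_mono[OF w(3)]) (rule assms(4)[OF w(1) w(1)])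
  moreover have "\<forall>x\<in>set (map h w). length x = e"
    using assms(3) w(1) by simp
  ultimately show ?thesis
    using w(2) unfolding sa_path_def by (simp only: distinct_map successively_map simp_thms)
qed

lemma sa_path_append:
  assumes "sa_path d (u @ v)"
  shows "sa_path d u" "sa_path d v"
  using assms by (auto simp: sa_path_def successively_append_iff)

section \<open>Translating and cutting walks\<close>

lemma lattice_adj_diff:
  assumes "length x = length a" "length y = length a" "lattice_adj x y"
  shows "lattice_adj (map2 (-) x a) (map2 (-) y a)"
  using assms by (simp add: lattice_adj_def)

lemma map2_diff_add_cancel:
  "length x = length a \<Longrightarrow> map2 (+) (map2 (-) x a) a = (x :: int list)"
  by (auto intro: nth_equalityI)

lemma map2_diff_self: "map2 (-) x x = replicate (length x) (0 :: int)"
  by (auto intro: nth_equalityI)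

text \<open>The second walk is moved to the end point of the first, and \<open>tl\<close> removes
  the vertex that would occur twice. The result may intersect itself.\<close>

definition concat_walks :: "int list list \<Rightarrow> int list list \<Rightarrow> int list list" where
  "concat_walks u v = u @ tl (map (\<lambda>x. map2 (+) x (last u)) v)"

lemma saw_add_split:
  assumes "w \<in> saw d (m + n)"
  shows "take (Suc m) w \<in> saw d m"
    and "\<exists>v\<in>saw d n. w = concat_walks (take (Suc m) w) v"
proof -
  have w: "length w = Suc (m + n)" "hd w = replicate d 0" "sa_path d w"
    using assms by (auto simp: saw_iff_sa_path)
  have "sa_path d (take (Suc m) w)" "sa_path d (drop m w)"
    using w(3) sa_path_append[of d "take (Suc m) w" "drop (Suc m) w"]
      sa_path_append[of d "take m w" "drop m w"] by simp_all
  then show "take (Suc m) w \<in> saw d m"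
    using w by (simp add: saw_iff_sa_path)
  \<comment> \<open>The cut vertex \<open>a\<close> belongs to both pieces, as the end of the first
    and the start of the second; subtracting it moves the second piece to the origin.\<close>
  define a where "a = w ! m"
  have a: "length a = d" using w by (auto simp: a_def sa_path_def)
  let ?v = "map (\<lambda>x. map2 (-) x a) (drop m w)"
  have "inj_on (\<lambda>x. map2 (-) x a) {x. length x = d}"
    using a by (intro inj_on_inverseI[where g = "\<lambda>x. map2 (+) x a"]) (simp add: map2_diff_add_cancel)
  then have "sa_path d ?v"
    using a by (intro sa_path_map[OF \<open>sa_path d (drop m w)\<close>]) (auto intro: lattice_adj_diff)
  moreover have "hd ?v = replicate d 0"
    using w a by (simp add: hd_map hd_drop_conv_nth a_def[symmetric] map2_diff_self)
  ultimately have "?v \<in> saw d n"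
    using w by (simp add: saw_iff_sa_path)
  moreover have "last (take (Suc m) w) = a"
    using w by (simp add: a_def take_Suc_conv_app_nth)
  moreover have "map (\<lambda>x. map2 (+) x a) ?v = drop m w"
    unfolding map_map o_def
    by (rule map_idI) (use w(3) a in \<open>auto simp: sa_path_def map2_diff_add_cancel dest!: in_set_dropD\<close>)
  ultimately have "concat_walks (take (Suc m) w) ?v = w"
    by (simp add: concat_walks_def tl_drop drop_Suc[symmetric] del: map_map)
  with \<open>?v \<in> saw d n\<close> show "\<exists>v\<in>saw d n. w = concat_walks (take (Suc m) w) v"
    by metis
qed

lemma saw_0: "saw d 0 = {[replicate d 0]}"
  unfolding saw_def by (auto simp: length_Suc_conv)

text \<open>A single step changes each coordinate by at most 1, so its end lies in a finite
  box.\<close>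

lemma finite_saw_1: "finite (saw d 1)"
proof (rule finite_subset)
  let ?V = "{x. set x \<subseteq> {-1..1::int} \<and> length x = d}"
  show "finite {w. set w \<subseteq> ?V \<and> length w = 2}"
    by (intro finite_lists_length_eq) simp
  show "saw d 1 \<subseteq> {w. set w \<subseteq> ?V \<and> length w = 2}"
  proof
    fix w assume w: "w \<in> saw d 1"
    then obtain x where x: "w = [replicate d 0, x]" "length x = d"
      by (auto simp: saw_def length_Suc_conv eval_nat_numeral)
    have "(\<Sum>i<d. \<bar>x ! i\<bar>) = 1"
      using w x by (simp add: saw_def lattice_adj_def)
    then have "\<bar>x ! i\<bar> \<le> 1" if "i < d" for i
      using member_le_sum[of i "{..<d}" "\<lambda>i. \<bar>x ! i\<bar>"] that by simp
    then have "set x \<subseteq> {-1..1}"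
      using x by (force simp: in_set_conv_nth abs_le_iff)
    then show "w \<in> {w. set w \<subseteq> ?V \<and> length w = 2}"
      using x by auto
  qed
qed

text \<open>A covering by concatenations suffices for upper bounds: it yields both finiteness of
  \<open>saw d n\<close>, by induction from single steps, and submultiplicativity of the
  counts.\<close>

lemma saw_add_subset:
  "saw d (m + n) \<subseteq> (\<lambda>(u, v). concat_walks u v) ` (saw d m \<times> saw d n)"
proof
  fix w assume w: "w \<in> saw d (m + n)"
  from saw_add_split(2)[OF w] obtain v where
    "v \<in> saw d n" "w = concat_walks (take (Suc m) w) v" ..
  with saw_add_split(1)[OF w] show "w \<in> (\<lambda>(u, v). concat_walks u v) ` (saw d m \<times> saw d n)"
    by (intro image_eqI[where x = "(take (Suc m) w, v)"]) simp_all
qed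

lemma finite_saw [simp]: "finite (saw d n)"
proof (induction n)
  case (Suc n)
  then have "finite ((\<lambda>(u, v). concat_walks u v) ` (saw d n \<times> saw d 1))"
    using finite_saw_1[of d] by (intro finite_imageI finite_cartesian_product)
  then show ?case
    using saw_add_subset[of d n 1] by (simp add: finite_subset)
qed (simp add: saw_0)

lemma finite_pos_walks [simp]: "finite (pos_walks d n)"
  by (simp add: pos_walks_def)

lemma saw_count_add_le: "saw_count d (m + n) \<le> saw_count d m * saw_count d n"
proof -
  have "card (saw d (m + n)) \<le> card (saw d m \<times> saw d n)"
    by (rule surj_card_le[OF _ saw_add_subset]) simp
  then show ?thesis
    by (simp add: saw_count_def card_cartesian_product)
qed

text \<open>Removing the last step of a positive walk leaves a positive walk, and the removed step
  is one of the \<open>saw_count d 1\<close> possible steps.\<close>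

lemma card_pos_walks_Suc_le:
  "card (pos_walks d (Suc n)) \<le> card (pos_walks d n) * saw_count d 1"
proof -
  have "pos_walks d (Suc n) \<subseteq> (\<lambda>(u, v). concat_walks u v) ` (pos_walks d n \<times> saw d 1)"
  proof
    fix w assume w: "w \<in> pos_walks d (Suc n)"
    then have "w \<in> saw d (n + 1)" by (simp add: pos_walks_def)
    note split = saw_add_split[OF this]
    then obtain v where "v \<in> saw d 1" "w = concat_walks (take (Suc n) w) v"
      by blast
    moreover have "take (Suc n) w \<in> pos_walks d n"
      using split(1) w by (auto simp: pos_walks_def dest: in_set_takeD)
    ultimately show "w \<in> (\<lambda>(u, v). concat_walks u v) ` (pos_walks d n \<times> saw d 1)"
      by (intro image_eqI[where x = "(take (Suc n) w, v)"]) simp_all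
  qed
  then have "card (pos_walks d (Suc n)) \<le> card (pos_walks d n \<times> saw d 1)"
    by (intro surj_card_le) simp_all
  then show ?thesis
    by (simp add: saw_count_def card_cartesian_product)
qed

section \<open>Injections between families of walks\<close>

lemma card_pos_walks_le_cplus_0:
  assumes "d \<ge> 1"
  shows "card (pos_walks d n) \<le> cplus d (Suc n) 0"
proof -
  \<comment> \<open>\<open>up\<close> raises a vertex by one level. Prefixing the raised walk with
    the origin costs one step and leaves no visit.\<close>
  define up where "up = (\<lambda>x :: int list. x[d - 1 := x ! (d - 1) + 1])"
  let ?o = "replicate d (0 :: int)"
  have up_last: "up x ! (d - 1) = x ! (d - 1) + 1" if "length x = d" for x
    using assms that by (simp add: up_def)
  have inj: "inj_on up {x. length x = d}"
    using assms by (intro inj_on_inverseI[where g = "\<lambda>x. x[d - 1 := x ! (d - 1) - 1]"])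
      (auto simp: up_def)
  have adj: "lattice_adj (up x) (up y)" if "length x = d" "length y = d" "lattice_adj x y" for x y
  proof -
    have "(\<Sum>i<d. \<bar>up x ! i - up y ! i\<bar>) = (\<Sum>i<d. \<bar>x ! i - y ! i\<bar>)"
      using that by (intro sum.cong) (auto simp: up_def nth_list_update)
    then show ?thesis
      using that by (simp add: lattice_adj_def up_def)
  qed
  have adj0: "lattice_adj ?o (up ?o)"
  proof -
    have "(\<Sum>i<d. \<bar>?o ! i - up ?o ! i\<bar>) = (\<Sum>i<d. if i = d - 1 then 1 else 0)"
      using assms by (intro sum.cong) (auto simp: up_def nth_list_update)
    then show ?thesis
      using assms by (simp add: lattice_adj_def up_def)
  qed
  have maps: "?o # map up w \<in> {w \<in> pos_walks d (Suc n). visits d w = 0}"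
    if "w \<in> pos_walks d n" for w
  proof -
    have w: "length w = Suc n" "hd w = ?o" "sa_path d w" "\<forall>x\<in>set w. x ! (d - 1) \<ge> 0"
      using that by (auto simp: pos_walks_def saw_iff_sa_path)
    then have wne: "w \<noteq> []" by auto
    have pos: "up x ! (d - 1) > 0" if "x \<in> set w" for x
      using w that up_last by (force simp: sa_path_def)
    have "sa_path d (map up w)"
      by (rule sa_path_map[OF w(3) inj _ adj]) (auto simp: up_def)
    \<comment> \<open>Raised vertices have positive height, so the prefixed origin is not
      repeated.\<close>
    moreover have "?o \<notin> up ` set w"
    proof
      assume "?o \<in> up ` set w"
      then obtain x where "x \<in> set w" "up x = ?o" by auto
      with pos[of x] assms show False by simp
    qed
    moreover have "hd (map up w) = up ?o"
      using w wne by (simp add: hd_map)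
    ultimately have "sa_path d (?o # map up w)"
      using adj0 wne by (auto simp: sa_path_def successively_Cons)
    then have "?o # map up w \<in> pos_walks d (Suc n)"
      using w pos[THEN less_imp_le] assms by (simp add: pos_walks_def saw_iff_sa_path)
    moreover have "{i \<in> {1..<length (?o # map up w)}. ((?o # map up w) ! i) ! (d - 1) = 0} = {}"
    proof -
      have "((?o # map up w) ! i) ! (d - 1) \<noteq> 0" if "i \<in> {1..<length (?o # map up w)}" for i
      proof -
        have "(?o # map up w) ! i = up (w ! (i - 1))" "w ! (i - 1) \<in> set w"
          using that by (auto simp: nth_Cons')
        with pos[of "w ! (i - 1)"] show ?thesis by simp
      qed
      then show ?thesis by blast
    qed
    ultimately show ?thesis
      unfolding visits_def by (simp only: mem_Collect_eq card.empty)
  qed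
  have "inj_on (\<lambda>w. ?o # map up w) (pos_walks d n)"
  proof (rule inj_onI)
    fix u v assume uv: "u \<in> pos_walks d n" "v \<in> pos_walks d n" "?o # map up u = ?o # map up v"
    then have "inj_on up (set u \<union> set v)"
      by (intro inj_on_subset[OF inj]) (auto simp: pos_walks_def saw_def)
    with uv show "u = v"
      by (simp add: map_inj_on)
  qed
  then show ?thesis
    unfolding cplus_def using maps by (intro card_inj_on_le) auto
qed

lemma cplus_0_0:
  assumes "d \<ge> 1"
  shows "cplus d 0 0 = 1"
proof -
  have "{i \<in> {1..<length w}. P i} = {}" if "length w = 1" for w :: "int list list" and P
    using that by auto
  then have "visits d w = 0" if "length w = 1" for w
    unfolding visits_def using that by (metis card.empty)
  moreover have "pos_walks d 0 = {[replicate d 0]}"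
    using assms unfolding pos_walks_def saw_0 by auto
  ultimately have "{w \<in> pos_walks d 0. visits d w = 0} = {[replicate d 0]}"
    by force
  then show ?thesis by (simp add: cplus_def)
qed

text \<open>Appending a zero coordinate places a walk in the boundary hyperplane, where each of its
  \<open>n\<close> vertices after the origin is a visit.\<close>

lemma saw_count_le_cplus:
  "saw_count d n \<le> cplus (Suc d) n n"
proof -
  let ?h = "\<lambda>x. x @ [0 :: int]"
  have maps: "map ?h w \<in> {w \<in> pos_walks (Suc d) n. visits (Suc d) w = n}" if "w \<in> saw d n" for w
  proof -
    have w: "length w = Suc n" "hd w = replicate d 0" "sa_path d w"
      using that by (auto simp: saw_iff_sa_path)
    then have wne: "w \<noteq> []" by auto
    have "sa_path (Suc d) (map ?h w)"
      by (rule sa_path_map[OF w(3)]) (auto simp: lattice_adj_def nth_append inj_on_def)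
    moreover have "hd (map ?h w) = replicate (Suc d) 0"
      using w wne by (simp add: hd_map replicate_append_same)
    moreover have len: "length x = d" if "x \<in> set w" for x
      using w that by (simp add: sa_path_def)
    ultimately have "map ?h w \<in> pos_walks (Suc d) n"
      using w by (auto simp: pos_walks_def saw_iff_sa_path nth_append)
    moreover have "{i \<in> {1..<length (map ?h w)}. (map ?h w ! i) ! (Suc d - 1) = 0} = {1..<Suc n}"
      using len w by (auto simp: nth_append)
    ultimately show ?thesis
      by (simp add: visits_def)
  qed
  have "inj_on (map ?h) (saw d n)"
    by (intro inj_onI) (auto dest: map_injective simp: inj_def)
  then show ?thesis
    unfolding cplus_def saw_count_def using maps by (intro card_inj_on_le) auto
qed

lemma card_pos_walks_le_saw_count: "card (pos_walks d n) \<le> saw_count d n"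
  unfolding saw_count_def by (intro card_mono) (auto simp: pos_walks_def)

lemma cplus_le_card_pos_walks: "cplus d n v \<le> card (pos_walks d n)"
  unfolding cplus_def by (intro card_mono) auto

lemma sum_cplus_le_card_pos_walks: "(\<Sum>v\<le>n. cplus d n v) \<le> card (pos_walks d n)"
proof -
  have "(\<Sum>v\<le>n. cplus d n v) = card (\<Union>v\<le>n. {w \<in> pos_walks d n. visits d w = v})"
    unfolding cplus_def by (intro card_UN_disjoint[symmetric]) auto
  also have "\<dots> \<le> card (pos_walks d n)"
    by (intro card_mono) auto
  finally show ?thesis .
qed

text \<open>Repeated lifting of the trivial walk produces a positive walk of every length.\<close>

lemma card_pos_walks_ge_1:
  assumes "d \<ge> 1"
  shows "1 \<le> card (pos_walks d n)"
proof (induction n)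
  case 0
  show ?case using cplus_0_0[OF assms] cplus_le_card_pos_walks[of d 0 0] by simp
next
  case (Suc n)
  then show ?case
    using card_pos_walks_le_cplus_0[OF assms, of n] cplus_le_card_pos_walks[of d "Suc n" 0] by linarith
qed

lemma saw_count_ge_1:
  assumes "d \<ge> 1"
  shows "1 \<le> saw_count d n"
  using card_pos_walks_ge_1[OF assms, of n] card_pos_walks_le_saw_count[of d n] by linarith

lemma saw_count_mono: "saw_count d n \<le> saw_count (Suc d) n"
  using saw_count_le_cplus[of d n] cplus_le_card_pos_walks[of "Suc d" n n]
    card_pos_walks_le_saw_count[of "Suc d" n] by linarith

section \<open>Growth constants\<close>

lemma saw_count_root_tendsto:
  assumes "d \<ge> 1"
  obtains L where "L \<ge> 1" "(\<lambda>n. root n (real (saw_count d n))) \<longlonglongrightarrow> L"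
    "\<And>n. L ^ n \<le> real (saw_count d n)"
proof (rule fekete_submultiplicative[of "\<lambda>n. real (saw_count d n)"])
  show "real (saw_count d (m + n)) \<le> real (saw_count d m) * real (saw_count d n)" for m n
    using saw_count_add_le[of d m n] by (simp flip: of_nat_mult)
qed (use saw_count_ge_1[OF assms] that in auto)

lemma growth_const_tendsto:
  assumes "d \<ge> 2"
  shows "(\<lambda>n. root n (real (saw_count d n))) \<longlonglongrightarrow> growth_const d"
proof -
  obtain L where "(\<lambda>n. root n (real (saw_count d n))) \<longlonglongrightarrow> L"
    using saw_count_root_tendsto[of d] assms by auto
  then show ?thesis
    using assms limI[of _ L] by (simp add: growth_const_def)
qed

lemma
  assumes "d \<ge> 1"
  shows growth_const_ge_1: "growth_const d \<ge> 1"
    and growth_const_power_le: "growth_const d ^ n \<le> real (saw_count d n)"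
proof -
  obtain L where L: "L \<ge> 1" "(\<lambda>n. root n (real (saw_count d n))) \<longlonglongrightarrow> L"
      "\<And>n. L ^ n \<le> real (saw_count d n)"
    using saw_count_root_tendsto[OF assms] by blast
  \<comment> \<open>For \<open>d = 1\<close> the value is the convention 1, and the power bound
    follows from \<open>saw_count d n\<close> being at least 1.\<close>
  have "growth_const d = (if d = 1 then 1 else L)"
    unfolding growth_const_def using limI[OF L(2)] by simp
  then show "growth_const d \<ge> 1" "growth_const d ^ n \<le> real (saw_count d n)"
    using L saw_count_ge_1[OF assms, of n] by auto
qed

lemma growth_const_mono:
  assumes "d \<ge> 1"
  shows "growth_const d \<le> growth_const (Suc d)"
proof (cases "d = 1")
  case True
  then show ?thesis using growth_const_ge_1[of "Suc d"] by (simp add: growth_const_def)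
next
  case False
  have "\<forall>\<^sub>F n in sequentially. root n (real (saw_count d n)) \<le> root n (real (saw_count (Suc d) n))"
    using eventually_ge_at_top[of 1] by eventually_elim (simp add: saw_count_mono)
  with False assms show ?thesis
    by (intro tendsto_le[OF _ growth_const_tendsto growth_const_tendsto]) auto
qed

text \<open>The n-th roots are below \<open>\<beta>\<close> from some index \<open>M\<close> on, and
  \<open>C\<close> absorbs the finitely many earlier counts.\<close>

lemma saw_count_le_exponential:
  assumes "d \<ge> 2" "growth_const d < \<beta>"
  obtains C where "C \<ge> 1" "\<And>n. real (saw_count d n) \<le> C * \<beta> ^ n"
proof -
  have \<beta>: "\<beta> \<ge> 1" using growth_const_ge_1[of d] assms by simp
  have "\<forall>\<^sub>F n in sequentially. root n (real (saw_count d n)) < \<beta>"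
    using growth_const_tendsto[OF assms(1)] assms(2) by (rule order_tendstoD)
  then obtain M where M: "\<And>n. n \<ge> M \<Longrightarrow> root n (real (saw_count d n)) < \<beta>"
    by (auto simp: eventually_at_top_linorder)
  define C where "C = 1 + (\<Sum>n\<le>M. real (saw_count d n))"
  have C: "C \<ge> 1" unfolding C_def by (simp add: sum_nonneg)
  have "real (saw_count d n) \<le> C * \<beta> ^ n" for n
  proof (cases "n \<le> M")
    case True
    then have "real (saw_count d n) \<le> C"
      using member_le_sum[of n "{..M}" "\<lambda>n. real (saw_count d n)"] by (simp add: C_def)
    also have "\<dots> \<le> C * \<beta> ^ n"
      using C \<beta> by (simp add: mult_le_cancel_left1)
    finally show ?thesis .
  next
    case False
    then have "real (saw_count d n) = root n (real (saw_count d n)) ^ n"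
      by (intro real_root_pow_pos2[symmetric]) auto
    also have "\<dots> \<le> \<beta> ^ n"
      using M[of n] False by (intro power_mono) auto
    also have "\<dots> \<le> C * \<beta> ^ n"
      using C \<beta> by (simp add: mult_le_cancel_right1)
    finally show ?thesis .
  qed
  with C that show thesis by blast
qed

section \<open>The partition function\<close>

lemma coeff_GN:
  "coeff (GN d N t) v = complex_of_real (\<Sum>n\<in>{v..N}. real (cplus d n v) * t ^ n)"
proof -
  have "coeff (GN d N t) v =
      (\<Sum>n=0..N. if v \<le> n then complex_of_real (real (cplus d n v) * t ^ n) else 0)"
    unfolding GN_def coeff_sum coeff_monom by (intro sum.cong refl) simp
  also have "\<dots> = (\<Sum>n\<in>{v..N}. complex_of_real (real (cplus d n v) * t ^ n))"
    by (intro sum.mono_neutral_cong_right) auto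
  finally show ?thesis by simp
qed

text \<open>The coefficient of the N-th power is \<open>cplus d N N * t ^ N\<close>, which is
  positive because of walks inside the boundary hyperplane.\<close>

lemma degree_GN:
  assumes "d \<ge> 2" "t > 0"
  shows "degree (GN d N t) = N"
proof (rule antisym)
  show "degree (GN d N t) \<le> N"
    by (rule degree_le) (simp add: coeff_GN)
  have "saw_count (d - 1) N \<ge> 1" "saw_count (d - 1) N \<le> cplus d N N"
    using assms saw_count_ge_1[of "d - 1" N] saw_count_le_cplus[of "d - 1" N] by auto
  then have "coeff (GN d N t) N \<noteq> 0"
    using assms by (simp add: coeff_GN)
  then show "N \<le> degree (GN d N t)"
    by (rule le_degree)
qed

text \<open>The coefficients are nonnegative, so the left side is the value at a = 1; exchanging the
  sums over \<open>i \<le> n \<le> N\<close> groups the walks by length.\<close>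

lemma sum_cmod_coeff_GN_le:
  assumes "t > 0"
  shows "(\<Sum>i\<le>N. cmod (coeff (GN d N t) i)) \<le> (\<Sum>n\<le>N. real (card (pos_walks d n)) * t ^ n)"
proof -
  have "(\<Sum>i\<le>N. cmod (coeff (GN d N t) i)) = (\<Sum>i\<le>N. \<Sum>n\<in>{i..N}. real (cplus d n i) * t ^ n)"
    unfolding coeff_GN norm_of_real using assms
    by (intro sum.cong refl abs_of_nonneg sum_nonneg) simp
  also have "\<dots> = (\<Sum>n\<le>N. \<Sum>i\<le>n. real (cplus d n i) * t ^ n)"
  proof -
    have "(\<Sum>i\<le>N. \<Sum>n\<in>{i..N}. f n i) = (\<Sum>n\<le>N. \<Sum>i\<le>n. f n i)" for f :: "nat \<Rightarrow> nat \<Rightarrow> real"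
    proof -
      have "(\<Sum>i\<le>N. \<Sum>n\<in>{i..N}. f n i) = (\<Sum>i\<le>N. \<Sum>n\<le>N. if i \<le> n then f n i else 0)"
        by (intro sum.cong refl sum.mono_neutral_cong_left) auto
      also have "\<dots> = (\<Sum>n\<le>N. \<Sum>i\<le>N. if i \<le> n then f n i else 0)"
        by (rule sum.swap)
      also have "\<dots> = (\<Sum>n\<le>N. \<Sum>i\<le>n. f n i)"
        by (intro sum.cong refl sum.mono_neutral_cong_right) auto
      finally show ?thesis .
    qed
    then show ?thesis .
  qed
  also have "\<dots> = (\<Sum>n\<le>N. real (\<Sum>i\<le>n. cplus d n i) * t ^ n)"
    by (simp add: sum_distrib_right)
  also have "\<dots> \<le> (\<Sum>n\<le>N. real (card (pos_walks d n)) * t ^ n)"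
    using assms by (intro sum_mono mult_right_mono of_nat_mono sum_cplus_le_card_pos_walks) simp
  finally show ?thesis .
qed

text \<open>Lifting a positive walk by one unit and prepending a vertical step removes all visits, so
  the constant coefficient is comparable to the value at a = 1.\<close>

lemma pos_walks_sum_le_coeff_GN_0:
  assumes "d \<ge> 2" "t > 0"
  shows "(\<Sum>n\<le>N. real (card (pos_walks d n)) * t ^ n)
           \<le> real (saw_count d 1) * cmod (coeff (GN d N t) 0)"
proof -
  let ?K = "real (saw_count d 1)"
  have bound: "real (card (pos_walks d n)) \<le> ?K * real (cplus d n 0)" for n
  proof (cases n)
    case 0
    have "card (pos_walks d 0) \<le> 1"
      using card_pos_walks_le_saw_count[of d 0] by (simp add: saw_count_def saw_0)
    moreover have "?K \<ge> 1" using saw_count_ge_1[of d 1] assms by simp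
    ultimately show ?thesis
      using 0 assms cplus_0_0[of d] by simp
  next
    case (Suc m)
    have "card (pos_walks d m) * saw_count d 1 \<le> cplus d n 0 * saw_count d 1"
      using card_pos_walks_le_cplus_0[of d m] assms Suc by (intro mult_right_mono) auto
    with card_pos_walks_Suc_le[of d m] Suc
    have "card (pos_walks d n) \<le> cplus d n 0 * saw_count d 1"
      by (simp only: order_trans)
    then have "real (card (pos_walks d n)) \<le> real (cplus d n 0 * saw_count d 1)"
      by (rule of_nat_mono)
    then show ?thesis by (simp add: mult.commute)
  qed
  have "(\<Sum>n\<le>N. real (card (pos_walks d n)) * t ^ n) \<le> (\<Sum>n\<le>N. ?K * real (cplus d n 0) * t ^ n)"
    using assms by (intro sum_mono mult_right_mono bound) simp
  also have "\<dots> = ?K * (\<Sum>n\<in>{0..N}. real (cplus d n 0) * t ^ n)"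
    by (simp add: sum_distrib_left mult.assoc atMost_atLeast0)
  also have "(\<Sum>n\<in>{0..N}. real (cplus d n 0) * t ^ n) = cmod (coeff (GN d N t) 0)"
    unfolding coeff_GN norm_of_real using assms
    by (intro abs_of_nonneg[symmetric] sum_nonneg) simp
  finally show ?thesis .
qed

lemma pos_walks_sum_ge_1:
  assumes "d \<ge> 1" "t > 0"
  shows "1 \<le> (\<Sum>n\<le>N. real (card (pos_walks d n)) * t ^ n)"
proof -
  have "1 \<le> real (card (pos_walks d 0)) * t ^ 0"
    using card_pos_walks_ge_1[OF assms(1), of 0] by simp
  also have "\<dots> \<le> (\<Sum>n\<le>N. real (card (pos_walks d n)) * t ^ n)"
    using assms by (intro member_le_sum) auto
  finally show ?thesis .
qed

lemma coeff_GN_0_nonzero: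
  assumes "d \<ge> 2" "t > 0"
  shows "coeff (GN d N t) 0 \<noteq> 0"
  using pos_walks_sum_le_coeff_GN_0[OF assms, of N] pos_walks_sum_ge_1[of d t N] assms by auto

section \<open>Asymptotics of the number of zeros\<close>

lemma pos_walks_sum_le_exponential:
  assumes C: "\<And>n. real (saw_count d n) \<le> C * \<beta> ^ n" "C \<ge> 1" and "t > 0" "t * \<beta> \<ge> 1"
  shows "(\<Sum>n\<le>N. real (card (pos_walks d n)) * t ^ n) \<le> C * real (N + 1) * (t * \<beta>) ^ N"
proof -
  have "real (card (pos_walks d n)) * t ^ n \<le> C * (t * \<beta>) ^ N" if "n \<le> N" for n
  proof -
    have "real (card (pos_walks d n)) \<le> C * \<beta> ^ n"
      using card_pos_walks_le_saw_count[of d n] C(1)[of n] by linarith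
    then have "real (card (pos_walks d n)) * t ^ n \<le> C * \<beta> ^ n * t ^ n"
      using assms by (intro mult_right_mono) auto
    also have "\<dots> = C * (t * \<beta>) ^ n"
      by (simp add: power_mult_distrib)
    \<comment> \<open>As \<open>t * \<beta> \<ge> 1\<close>, the bound for \<open>n = N\<close>
      dominates the others, whence the factor \<open>N + 1\<close>.\<close>
    also have "\<dots> \<le> C * (t * \<beta>) ^ N"
      using assms that by (intro mult_left_mono power_increasing) auto
    finally show ?thesis .
  qed
  then have "(\<Sum>n\<le>N. real (card (pos_walks d n)) * t ^ n) \<le> of_nat (card {..N}) * (C * (t * \<beta>) ^ N)"
    by (intro sum_bounded_above) auto
  then show ?thesis by (simp add: mult_ac)
qed

text \<open>Of the two logarithms of the coefficient sum, one is cancelled by the constant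
  coefficient up to \<open>ln (saw_count d 1)\<close>, and the other is bounded exponentially. The
  powers of \<open>t\<close> then cancel against the leading coefficient.\<close>

lemma zeros_GN_lower_bound:
  assumes d: "d \<ge> 2" and t: "t > 0" and \<rho>: "0 < \<rho>" "\<rho> < 1"
    and C: "\<And>n. real (saw_count d n) \<le> C * \<beta> ^ n" "C \<ge> 1" and \<beta>: "t * \<beta> \<ge> 1"
  shows "\<rho> * (real N - real (zeros_in (GN d N t) (closed_annulus \<rho>))) \<le>
    real N * ln (\<beta> / growth_const (d - 1)) + ln (real (N + 1)) + ln (C * real (saw_count d 1))"
proof -
  let ?p = "GN d N t" and ?\<mu> = "growth_const (d - 1)" and ?K = "real (saw_count d 1)"
  let ?G = "\<Sum>n\<le>N. real (card (pos_walks d n)) * t ^ n"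
  have \<mu>: "?\<mu> \<ge> 1" using d by (intro growth_const_ge_1) auto
  have \<beta>0: "\<beta> > 0" using \<beta> t zero_less_mult_pos[of t \<beta>] by linarith
  have K: "?K \<ge> 1" using saw_count_ge_1[of d 1] d by simp
  have c0: "coeff ?p 0 \<noteq> 0" by (rule coeff_GN_0_nonzero[OF d t])
  have G: "?G \<ge> 1" using d t by (intro pos_walks_sum_ge_1) auto
  have "0 < cmod (coeff ?p 0)" using c0 by simp
  also have "\<dots> \<le> (\<Sum>i\<le>N. cmod (coeff ?p i))"
    by (intro member_le_sum[of 0 "{..N}" "\<lambda>i. cmod (coeff ?p i)"]) auto
  finally have L1: "ln (\<Sum>i\<le>N. cmod (coeff ?p i)) \<le> ln ?G"
    using sum_cmod_coeff_GN_le[OF t] by (intro ln_mono)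
  have "ln ?G \<le> ln (?K * cmod (coeff ?p 0))"
    using G pos_walks_sum_le_coeff_GN_0[OF d t] by (intro ln_mono) auto
  then have a0: "ln ?G \<le> ln ?K + ln (cmod (coeff ?p 0))"
    using K c0 by (simp add: ln_mult_pos)
  have "ln ?G \<le> ln (C * real (N + 1) * (t * \<beta>) ^ N)"
    using G pos_walks_sum_le_exponential[OF C t \<beta>] by (intro ln_mono) auto
  also have "\<dots> = ln C + ln (real (N + 1)) + real N * (ln t + ln \<beta>)"
    using C(2) t \<beta>0 by (simp add: ln_mult_pos ln_realpow del: of_nat_Suc of_nat_add)
  finally have GU: "ln ?G \<le> ln C + ln (real (N + 1)) + real N * (ln t + ln \<beta>)" .
  have "?\<mu> ^ N \<le> real (cplus d N N)"
    using order_trans[OF growth_const_power_le of_nat_mono[OF saw_count_le_cplus], of "d - 1" N] d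
    by simp
  then have "?\<mu> ^ N * t ^ N \<le> real (cplus d N N) * t ^ N"
    using t by (intro mult_right_mono) auto
  also have "\<dots> = cmod (coeff ?p N)"
    using t by (simp add: coeff_GN norm_mult norm_power)
  finally have "ln (?\<mu> ^ N * t ^ N) \<le> ln (cmod (coeff ?p N))"
    using \<mu> t by (intro ln_mono) auto
  then have aN: "real N * (ln ?\<mu> + ln t) \<le> ln (cmod (coeff ?p N))"
    using \<mu> t by (simp add: ln_mult_pos ln_realpow distrib_left)
  have "\<rho> * (real N - real (zeros_in ?p (closed_annulus \<rho>))) \<le>
      2 * ln (\<Sum>i\<le>N. cmod (coeff ?p i)) - ln (cmod (coeff ?p 0)) - ln (cmod (coeff ?p N))"
    using zeros_in_closed_annulus_ge[OF \<rho> c0] by (simp add: degree_GN[OF d t])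
  also have "\<dots> \<le> ln ?K + (ln C + ln (real (N + 1)) + real N * (ln t + ln \<beta>))
      - real N * (ln ?\<mu> + ln t)"
    using L1 a0 GU aN by linarith
  also have "\<dots> = real N * ln (\<beta> / ?\<mu>) + ln (real (N + 1)) + ln (C * ?K)"
    using K C(2) \<beta>0 \<mu> by (simp add: ln_mult_pos ln_div algebra_simps)
  finally show ?thesis .
qed

text \<open>Two limits are taken in turn: \<open>N\<close> tends to infinity for a fixed
  \<open>\<beta>\<close> above \<open>growth_const d\<close>, then \<open>\<beta>\<close> decreases
  to \<open>growth_const d\<close>.\<close>

lemma liminf_zeros_GN_ge:
  assumes d: "d \<ge> 2" and t: "t > 1 / growth_const d" and \<rho>: "0 < \<rho>" "\<rho> < 1"
  shows "ereal (1 - ln (growth_const d / growth_const (d - 1)) / \<rho>)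
    \<le> liminf (\<lambda>N. ereal (real (zeros_in (GN d N t) (closed_annulus \<rho>)) / real N))"
    (is "_ \<le> ?L")
proof -
  let ?\<mu> = "growth_const d" and ?\<mu>' = "growth_const (d - 1)"
  have \<mu>: "?\<mu> \<ge> 1" "?\<mu>' \<ge> 1" using d by (auto intro: growth_const_ge_1)
  have t0: "t > 0" using t \<mu> by (smt (verit) zero_le_divide_1_iff)
  \<comment> \<open>The assumption on \<open>t\<close> enters here: it makes
    \<open>t * \<beta> \<ge> 1\<close> for every admissible \<open>\<beta>\<close>.\<close>
  have t\<mu>: "t * ?\<mu> > 1" using t \<mu> by (simp add: field_simps)
  have *: "ereal (1 - ln (\<beta> / ?\<mu>') / \<rho>) \<le> ?L" if \<beta>: "\<beta> > ?\<mu>" for \<beta>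
  proof -
    obtain C where C: "C \<ge> 1" "\<And>n. real (saw_count d n) \<le> C * \<beta> ^ n"
      using saw_count_le_exponential[OF d \<beta>] by blast
    have t\<beta>: "t * \<beta> \<ge> 1"
      using t\<mu> mult_strict_left_mono[OF \<beta> t0] by linarith
    define D where "D = ln (C * real (saw_count d 1))"
    let ?b = "\<lambda>N. 1 - (ln (\<beta> / ?\<mu>') + ln (real (N + 1)) / real N + D / real N) / \<rho>"
    have "(\<lambda>N. ln (real (N + 1)) / real N) \<longlonglongrightarrow> 0"
      by real_asymp
    moreover have "(\<lambda>N. D / real N) \<longlonglongrightarrow> 0"
      by (rule lim_const_over_n)
    ultimately have "?b \<longlonglongrightarrow> 1 - (ln (\<beta> / ?\<mu>') + 0 + 0) / \<rho>"
      using \<rho> by (intro tendsto_intros) auto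
    then have "(\<lambda>N. ereal (?b N)) \<longlonglongrightarrow> ereal (1 - ln (\<beta> / ?\<mu>') / \<rho>)"
      by simp
    then have "ereal (1 - ln (\<beta> / ?\<mu>') / \<rho>) = liminf (\<lambda>N. ereal (?b N))"
      by (intro lim_imp_Liminf[symmetric] trivial_limit_sequentially)
    also have "\<dots> \<le> ?L"
    proof (rule Liminf_mono)
      show "\<forall>\<^sub>F N in sequentially. ereal (?b N)
          \<le> ereal (real (zeros_in (GN d N t) (closed_annulus \<rho>)) / real N)"
        using eventually_gt_at_top[of 0]
      proof eventually_elim
        case (elim N)
        have "\<rho> * (real N - real (zeros_in (GN d N t) (closed_annulus \<rho>)))
            \<le> real N * ln (\<beta> / ?\<mu>') + ln (real (N + 1)) + D"
          unfolding D_def by (rule zeros_GN_lower_bound[OF d t0 \<rho> C(2,1) t\<beta>])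
        then have "\<rho> * (real N - real (zeros_in (GN d N t) (closed_annulus \<rho>))) / real N
            \<le> (real N * ln (\<beta> / ?\<mu>') + ln (real (N + 1)) + D) / real N"
          by (rule divide_right_mono) simp
        also have "\<dots> = ln (\<beta> / ?\<mu>') + ln (real (N + 1)) / real N + D / real N"
          using elim by (simp add: add_divide_distrib)
        also have "\<rho> * (real N - real (zeros_in (GN d N t) (closed_annulus \<rho>))) / real N
            = (1 - real (zeros_in (GN d N t) (closed_annulus \<rho>)) / real N) * \<rho>"
          using elim by (simp add: divide_simps)
        finally have "1 - real (zeros_in (GN d N t) (closed_annulus \<rho>)) / real N
            \<le> (ln (\<beta> / ?\<mu>') + ln (real (N + 1)) / real N + D / real N) / \<rho>"
          using \<rho>(1) by (simp only: pos_le_divide_eq)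
        then show ?case
          unfolding ereal_less_eq by linarith
      qed
    qed
    finally show ?thesis .
  qed
  \<comment> \<open>The lower limit \<open>?L\<close> does not involve \<open>\<beta>\<close>, so
    the bound persists as \<open>\<beta>\<close> tends to \<open>growth_const d\<close> from the
    right.\<close>
  have "((\<lambda>\<beta>. 1 - ln (\<beta> / ?\<mu>') / \<rho>) \<longlongrightarrow> 1 - ln (?\<mu> / ?\<mu>') / \<rho>) (at_right ?\<mu>)"
    using \<mu> \<rho> by (intro tendsto_intros) auto
  then have "((\<lambda>\<beta>. ereal (1 - ln (\<beta> / ?\<mu>') / \<rho>)) \<longlongrightarrow> ereal (1 - ln (?\<mu> / ?\<mu>') / \<rho>)) (at_right ?\<mu>)"
    by simp
  moreover have "\<forall>\<^sub>F \<beta> in at_right ?\<mu>. ereal (1 - ln (\<beta> / ?\<mu>') / \<rho>) \<le> ?L"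
    using eventually_at_right_less[of ?\<mu>] by eventually_elim (rule *)
  ultimately show ?thesis
    by (intro tendsto_upperbound[of _ _ "at_right ?\<mu>"]) auto
qed

text \<open>Since the polynomial has degree \<open>N\<close>, dividing by \<open>N\<close> gives the
  proportion of zeros. A positive fraction in the open annulus is expressed by a positive lower
  limit of this proportion.\<close>

theorem theorem2p10:
  fixes d :: nat and t \<rho> :: real
  assumes "d \<ge> 2"
    and "t > 1 / growth_const d"
    and "ln (growth_const d / growth_const (d - 1)) < \<rho>" and "\<rho> < 1"
  shows "let \<zeta> = ln (growth_const d / growth_const (d - 1));
             \<nu> = (\<lambda>N. real (zeros_in (GN d N t) (closed_annulus \<rho>)))
         in 0 < 1 - \<zeta> / \<rho>
          \<and> ereal (1 - \<zeta> / \<rho>) \<le> liminf (\<lambda>N. ereal (\<nu> N / real N))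
          \<and> liminf (\<lambda>N. ereal (\<nu> N / real N)) \<le> limsup (\<lambda>N. ereal (\<nu> N / real N))
          \<and> limsup (\<lambda>N. ereal (\<nu> N / real N)) \<le> 1
          \<and> 0 < liminf (\<lambda>N. ereal (real (zeros_in (GN d N t) (open_annulus \<rho>)) / real N))"
proof -
  let ?\<zeta> = "ln (growth_const d / growth_const (d - 1))"
  have \<mu>: "growth_const d \<ge> 1" "growth_const (d - 1) \<ge> 1"
    using assms(1) by (auto intro: growth_const_ge_1)
  have t: "t > 0" using assms(2) \<mu> by (smt (verit) zero_le_divide_1_iff)
  have "growth_const (d - 1) \<le> growth_const d"
    using growth_const_mono[of "d - 1"] assms(1) by simp
  \<comment> \<open>Monotonicity of the growth constants makes \<open>?\<zeta>\<close> nonnegative,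
    and this is what forces \<open>\<rho>\<close> to be positive.\<close>
  then have \<zeta>: "?\<zeta> \<ge> 0" using \<mu> by simp
  then have \<rho>: "\<rho> > 0" using assms(3) by linarith
  have nz: "GN d N t \<noteq> 0" for N
    using coeff_GN_0_nonzero[OF assms(1) t, of N] by auto
  have "real (zeros_in (GN d N t) S) / real N \<le> 1" for N S
    using zeros_in_le_degree[OF nz, of N S] degree_GN[OF assms(1) t, of N] by (simp add: divide_le_eq)
  then have sup: "limsup (\<lambda>N. ereal (real (zeros_in (GN d N t) S) / real N)) \<le> 1" for S
    by (intro Limsup_bounded) (simp add: one_ereal_def)
  \<comment> \<open>Any \<open>\<sigma>\<close> strictly between works:
    \<open>\<sigma> < \<rho>\<close> puts its closed annulus inside the open one, and
    \<open>?\<zeta> < \<sigma>\<close> keeps the lower bound positive.\<close>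
  obtain \<sigma> where \<sigma>: "?\<zeta> < \<sigma>" "\<sigma> < \<rho>" using dense[OF assms(3)] by blast
  have "closed_annulus \<sigma> \<subseteq> open_annulus \<rho>"
  proof -
    have "1 / (1 - \<sigma>) < 1 / (1 - \<rho>)"
      using \<sigma> assms(4) by (intro divide_strict_left_mono) auto
    then show ?thesis
      using \<sigma> by (auto simp: closed_annulus_def open_annulus_def)
  qed
  then have mono: "zeros_in (GN d N t) (closed_annulus \<sigma>) \<le> zeros_in (GN d N t) (open_annulus \<rho>)" for N
    by (intro zeros_in_mono nz)
  have "0 < ereal (1 - ?\<zeta> / \<sigma>)"
    using \<sigma> \<zeta> by simp
  also have "\<dots> \<le> liminf (\<lambda>N. ereal (real (zeros_in (GN d N t) (closed_annulus \<sigma>)) / real N))"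
    using assms \<sigma> \<zeta> by (intro liminf_zeros_GN_ge) auto
  also have "\<dots> \<le> liminf (\<lambda>N. ereal (real (zeros_in (GN d N t) (open_annulus \<rho>)) / real N))"
    by (intro Liminf_mono always_eventually allI) (simp add: divide_right_mono mono)
  finally have "0 < liminf (\<lambda>N. ereal (real (zeros_in (GN d N t) (open_annulus \<rho>)) / real N))" .
  moreover have "0 < 1 - ?\<zeta> / \<rho>" using assms(3) \<rho> by simp
  moreover have "ereal (1 - ?\<zeta> / \<rho>)
      \<le> liminf (\<lambda>N. ereal (real (zeros_in (GN d N t) (closed_annulus \<rho>)) / real N))"
    using assms \<rho> by (intro liminf_zeros_GN_ge) auto
  ultimately show ?thesis
    unfolding Let_def using sup by (auto intro: Liminf_le_Limsup)
qed

end
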